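(* ComplEx cannot enforce non-trivial subsumption. That is, for every integer $k\ge 1$, there do not exist relation embeddings $\mathbf r,\mathbf s\in\mathbb C^k$ such that both (i) $\mu(\mathbf h,\mathbf s,\mathbf t)\ge \mu(\mathbf h,\mathbf r,\mathbf t)$ for all $\mathbf h,\mathbf t\in\mathbb C^k$, and (ii) there exist $\mathbf a,\mathbf b\in\mathbb C^k$ with $\mu(\mathbf a,\mathbf s,\mathbf b)>\mu(\mathbf a,\mathbf r,\mathbf b)$, where $\mu$ is the ComplEx score function.
   Context: For vectors $\mathbf x,\mathbf y,\mathbf z$ of length $k$, write $\langle \mathbf x,\mathbf y,\mathbf z\rangle=\sum_{\ell=1}^k x_\ell y_\ell z_\ell$. In the ComplEx model with embedding size $k$, every entity and every relation is embedded as a vector in $\mathbb C^k$, and every vector in $\mathbb C^k$ is a legal entity embedding. The probability assigned to a triple (head $h$, relation $r$, tail $t$) with embeddings $\mathbf h,\mathbf r,\mathbf t$ is $\mu(\mathbf h,\mathbf r,\mathbf t)=\sigma(\mathrm{Re}\,\langle \mathbf h,\mathbf r,\overline{\mathbf t}\rangle)$, where $\sigma(x)=1/(1+e^{-x})$ and $\overline{\mathbf t}$ is the element-wise complex conjugate. A subsumption states that relation $r$ is a subproperty of relation $s$: $(h,r,t)\rightarrow(h,s,t)$ for all possible entities $h,t$, i.e. all those with a legal embedding. A model enforces it if $\mu(\mathbf h,\mathbf r,\mathbf t)\le\mu(\mathbf h,\mathbf s,\mathbf t)$ for all legal entity embeddings $\mathbf h,\mathbf t$. It is non-trivial if it is not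 symmetric, i.e. the inequality is strict for some pair of legal entity embeddings. *)

theory Defs
  imports "HOL-Analysis.Analysis"
begin

definition triple_prod :: "'a::comm_semiring_1 ^ 'k \<Rightarrow> 'a ^ 'k \<Rightarrow> 'a ^ 'k \<Rightarrow> 'a" where
  "triple_prod x y z = (\<Sum>l\<in>UNIV. x $ l * y $ l * z $ l)"

definition cnj_vec :: "complex ^ 'k \<Rightarrow> complex ^ 'k" where
  "cnj_vec t = (\<chi> l. cnj (t $ l))"

definition sigmoid :: "real \<Rightarrow> real" where
  "sigmoid x = 1 / (1 + exp (- x))"

(* The embedding size k is CARD('k), which is positive since every type is nonempty. *)
definition complex_score :: "complex ^ 'k \<Rightarrow> complex ^ 'k \<Rightarrow> complex ^ 'k \<Rightarrow> real" where
  "complex_score h r t = sigmoid (Re (triple_prod h r (cnj_vec t)))"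

(* r is the embedding of the subproperty, s that of the superproperty;
   every vector is a legal entity embedding. *)
definition enforces_subsumption :: "complex ^ 'k \<Rightarrow> complex ^ 'k \<Rightarrow> bool" where
  "enforces_subsumption r s \<longleftrightarrow> (\<forall>h t. complex_score h r t \<le> complex_score h s t)"

definition nontrivial_subsumption :: "complex ^ 'k \<Rightarrow> complex ^ 'k \<Rightarrow> bool" where
  "nontrivial_subsumption r s \<longleftrightarrow> (\<exists>a b. complex_score a r b < complex_score a s b)"

end

(* The score exponent is odd in the head embedding, so applying the enforced inequality to both
   a and -a forces equality of the scores under r and s. *)
theory Submission
  imports Defs
begin

text \<open>Since the sigmoid is strictly increasing (\<open>sigmoid_le_iff\<close>), comparing
  scores means comparing exponents. These are real-linear in the head, and a linear functional
  dominated by another everywhere must equal it, so enforcement leaves no strict pair.\<close>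

lemma sigmoid_le_iff: "sigmoid x \<le> sigmoid y \<longleftrightarrow> x \<le> y"
proof -
  \<comment> \<open>Positive denominators let \<open>divide_simps\<close> cross-multiply without
    sign cases.\<close>
  have "1 + exp (- z) > 0" for z :: real
    by (simp add: add_pos_pos)
  then show ?thesis
    by (simp add: sigmoid_def divide_simps)
qed

lemma triple_prod_minus_left:
  fixes x y z :: "'a::comm_ring_1 ^ 'k"
  shows "triple_prod (- x) y z = - triple_prod x y z"
  by (simp add: triple_prod_def sum_negf)

theorem theorem1:
  shows "\<not> (\<exists>r s :: complex ^ 'k. enforces_subsumption r s \<and> nontrivial_subsumption r s)"
proof
  assume "\<exists>r s :: complex ^ 'k. enforces_subsumption r s \<and> nontrivial_subsumption r s"
  then obtain r s a b :: "complex ^ 'k"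
    where le: "\<And>h t. complex_score h r t \<le> complex_score h s t"
      and less: "complex_score a r b < complex_score a s b"
    unfolding enforces_subsumption_def nontrivial_subsumption_def by blast
  \<comment> \<open>At head \<open>- a\<close> both exponents change sign, which reverses the
    enforced inequality at \<open>a\<close>.\<close>
  have "complex_score a s b \<le> complex_score a r b"
    using le[of "- a" b] by (simp add: complex_score_def sigmoid_le_iff triple_prod_minus_left)
  with less show False by simp
qed

end
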